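(* The Prime $k$-tuples Conjecture implies that there are infinitely many Lucas-Carmichael integers of degree $2$ with exactly three prime factors.
   Context: A Lucas-Carmichael integer is a square-free positive composite integer $n$ such that $p+1 \mid n+1$ for every prime $p$ dividing $n$. For an integer $b\ge 2$ and a positive integer $N$, $S_b(N)$ denotes the sum of the base-$b$ digits of $N$. The degree of a Lucas-Carmichael integer $n$ is the integer $\alpha = \max_{p\mid n} \frac{S_{p+2}(n+2)-1}{p+1}$, the maximum being over the prime divisors $p$ of $n$. Prime $k$-tuples Conjecture: Let $a_1,\ldots,a_k$ be positive integers, and let $b_1,\ldots,b_k$ be nonzero integers. For $m\ge 1$, define $f(m)=\prod_{i=1}^k (a_i m+b_i)$. Let $P(x)$ denote the number of positive integers $m\le x$ for which $a_i m+b_i$ is prime for each $i=1,\ldots,k$. The conjecture states that if no prime divides $f(m)$ for every $m$, then there exists $c>0$ such that $P(x)\sim \frac{cx}{\log^k x}$ as $x\to\infty$. *)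

theory Defs
  imports
    Complex_Main
    "HOL-Computational_Algebra.Primes"
    "HOL-Computational_Algebra.Squarefree"
    "HOL-Library.Landau_Symbols"
begin

text \<open>
  The \<open>i\<close>-th base-\<open>b\<close> digit of \<open>N\<close> is \<open>(N div b ^ i) mod b\<close>; for \<open>b \<ge> 2\<close> it vanishes
  for all \<open>i > N\<close>, so the sum below runs over all nonzero digits.
\<close>

definition digit_sum :: "nat \<Rightarrow> nat \<Rightarrow> nat" where
  "digit_sum b N = (\<Sum>i\<le>N. (N div b ^ i) mod b)"

definition lucas_carmichael :: "nat \<Rightarrow> bool" where
  "lucas_carmichael n \<longleftrightarrow>
     n > 1 \<and> \<not> prime n \<and> squarefree n \<and>
     (\<forall>p. prime p \<and> p dvd n \<longrightarrow> (p + 1) dvd (n + 1))"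

text \<open>
  Rational-valued, so that the division is exact division rather than truncating
  division of natural numbers.
\<close>

definition lc_degree :: "nat \<Rightarrow> rat" where
  "lc_degree n =
     Max ((\<lambda>p. (of_nat (digit_sum (p + 2) (n + 2)) - 1) / of_nat (p + 1)) ` {p. prime p \<and> p dvd n})"

text \<open>
  The \<open>k\<close> linear forms \<open>a\<^sub>i m + b\<^sub>i\<close> are required to be pairwise distinct. This is tacit in
  the usual formulation; without it the conjecture is false: listing the form \<open>m + 1\<close>
  twice gives \<open>k = 2\<close>, but the count grows like \<open>x / ln x\<close>. Primality is that of \<^typ>\<open>int\<close>,
  where primes are positive.
\<close>

definition tuple_count :: "nat \<Rightarrow> (nat \<Rightarrow> nat) \<Rightarrow> (nat \<Rightarrow> int) \<Rightarrow> real \<Rightarrow> nat" where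
  "tuple_count k a b x =
     card {m::nat. m \<ge> 1 \<and> real m \<le> x \<and> (\<forall>i\<in>{1..k}. prime (int (a i) * int m + b i))}"

definition prime_k_tuples_conjecture :: bool where
  "prime_k_tuples_conjecture \<longleftrightarrow>
     (\<forall>k\<ge>1. \<forall>(a :: nat \<Rightarrow> nat) (b :: nat \<Rightarrow> int).
        (\<forall>i\<in>{1..k}. a i > 0) \<longrightarrow>
        (\<forall>i\<in>{1..k}. b i \<noteq> 0) \<longrightarrow>
        inj_on (\<lambda>i. (a i, b i)) {1..k} \<longrightarrow>
        \<not> (\<exists>p::int. prime p \<and> (\<forall>m::nat. m \<ge> 1 \<longrightarrow> p dvd (\<Prod>i=1..k. int (a i) * int m + b i))) \<longrightarrow>
        (\<exists>c::real. c > 0 \<and>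
           (\<lambda>x::real. real (tuple_count k a b x)) \<sim>[at_top] (\<lambda>x. c * x / ln x ^ k)))"

end

theory Submission
  imports Defs
begin

text \<open>
  As with Chernick's Carmichael numbers, one takes \<open>n = (6m - 1)(12m - 1)(18m - 1)\<close>. The
  conjecture makes all three factors prime infinitely often, since each of them is \<open>-1\<close>
  modulo \<open>m\<close>, so that no fixed prime divides their product. The Korselt-type divisibilities are
  polynomial identities, and expanding \<open>n + 2\<close> to the bases \<open>6m + 1\<close>, \<open>12m + 1\<close>, \<open>18m + 1\<close>
  gives the normalised digit sums \<open>2\<close>, \<open>2\<close>, \<open>1\<close> for \<open>m \<ge> 12\<close>.
\<close>

text \<open>The summation bound in \<open>digit_sum\<close> is the number itself, so it shifts when
  a digit is split off; padding with zero digits makes bounds comparable.\<close>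

lemma digit_sum_extend:
  assumes "b \<ge> 2" "N \<le> K"
  shows "(\<Sum>i\<le>K. (N div b ^ i) mod b) = digit_sum b N"
  unfolding digit_sum_def
proof (rule sum.mono_neutral_right)
  have "N < b ^ i" if "N < i" for i
  proof -
    have "i < 2 ^ i" by (rule less_exp)
    also have "(2::nat) ^ i \<le> b ^ i" using assms(1) by (rule power_mono) simp
    finally show ?thesis using that by simp
  qed
  then show "\<forall>i\<in>{..K} - {..N}. (N div b ^ i) mod b = 0" by simp
qed (use assms in auto)

lemma digit_sum_less [simp]: "2 \<le> b \<Longrightarrow> d < b \<Longrightarrow> digit_sum b d = d"
  unfolding digit_sum_def
  by (cases d) (simp_all add: sum.atMost_Suc_shift div_mult2_eq del: sum.atMost_Suc)

lemma digit_sum_step: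
  assumes "b \<ge> 2" "d < b"
  shows "digit_sum b (d + b * M) = d + digit_sum b M"
proof -
  let ?N = "d + b * M"
  have "1 * M \<le> b * M" using assms by (intro mult_le_mono1) simp
  then have "M \<le> ?N" by linarith
  have "digit_sum b ?N = (\<Sum>i\<le>Suc ?N. (?N div b ^ i) mod b)"
    using assms(1) by (intro digit_sum_extend [symmetric]) simp_all
  also have "\<dots> = ?N mod b + (\<Sum>i\<le>?N. (?N div b ^ Suc i) mod b)"
    by (subst sum.atMost_Suc_shift) simp
  also have "(\<Sum>i\<le>?N. (?N div b ^ Suc i) mod b) = (\<Sum>i\<le>?N. (M div b ^ i) mod b)"
    using assms by (simp add: div_mult2_eq)
  also have "\<dots> = digit_sum b M"
    using assms(1) \<open>M \<le> ?N\<close> by (rule digit_sum_extend)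
  finally show ?thesis using assms(2) by simp
qed

text \<open>Horner form, least significant digit first. A leading \<open>d3 = 0\<close> is allowed,
  which covers three-digit expansions.\<close>

lemma digit_sum_4_digits:
  assumes "b \<ge> 2" "d0 < b" "d1 < b" "d2 < b" "d3 < b"
    "N = d0 + b * (d1 + b * (d2 + b * d3))"
  shows "digit_sum b N = d0 + d1 + d2 + d3"
  using assms by (simp add: digit_sum_step)

text \<open>
  Writing \<open>m = k + 12\<close> avoids truncated subtraction in the factors and in the digits of
  \<open>n + 2\<close>, which are the summands below, least significant first.
\<close>

lemma chernick_lucas_carmichael:
  fixes k :: nat
  defines "p \<equiv> 6 * k + 71" and "q \<equiv> 12 * k + 143" and "r \<equiv> 18 * k + 215"
  assumes "prime p" "prime q" "prime r"
  shows "lucas_carmichael (p * q * r)" "lc_degree (p * q * r) = 2"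
    "card {s. prime s \<and> s dvd p * q * r} = 3"
proof -
  let ?n = "p * q * r"
  have neq: "p \<noteq> q" "p \<noteq> r" "q \<noteq> r" by (simp_all add: p_def q_def r_def)
  have primes: "{s. prime s \<and> s dvd ?n} = {p, q, r}"
    using assms(4-6) by (auto simp: prime_dvd_mult_iff primes_dvd_imp_eq)
  show "card {s. prime s \<and> s dvd ?n} = 3"
    using neq by (simp add: primes)
  have "squarefree ?n"
    using assms(4-6) neq
    by (intro squarefree_mult_coprime squarefree_prime)
      (auto intro: primes_coprime)
  \<comment> \<open>A prime product would equal both of its prime divisors \<open>p\<close> and
    \<open>r\<close>.\<close>
  moreover have "\<not> prime ?n"
    using assms(4-6) by (metis dvd_triv_right mult.assoc dvd_triv_left neq(2) primes_dvd_imp_eq)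
  moreover have "?n > 1"
    using assms(4-6) by (metis less_1_mult prime_gt_1_nat)
  \<comment> \<open>With m = k + 12, \<open>?n + 1\<close> is 36m(36m^2 - 11m + 1), and the three
    divisors are 6m, 12m, 18m. The cofactors are 6, 3 and 2 times 36m^2 - 11m + 1.\<close>
  moreover have "p + 1 dvd ?n + 1"
    by (rule dvdI [of _ _ "216 * k ^ 2 + 5118 * k + 30318"])
      (simp add: p_def q_def r_def algebra_simps power2_eq_square)
  moreover have "q + 1 dvd ?n + 1"
    by (rule dvdI [of _ _ "108 * k ^ 2 + 2559 * k + 15159"])
      (simp add: p_def q_def r_def algebra_simps power2_eq_square)
  moreover have "r + 1 dvd ?n + 1"
    by (rule dvdI [of _ _ "72 * k ^ 2 + 1706 * k + 10106"])
      (simp add: p_def q_def r_def algebra_simps power2_eq_square)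
  moreover have "s = p \<or> s = q \<or> s = r" if "prime s \<and> s dvd ?n" for s
    using that primes by blast
  ultimately show "lucas_carmichael ?n"
    unfolding lucas_carmichael_def by metis
  have digit_sum_p: "digit_sum (p + 2) (?n + 2) = 2 * (p + 1) + 1"
  proof -
    \<comment> \<open>For b = \<open>p + 2\<close> the factors are b - 2, 2b - 3, 3b - 4, so
      \<open>?n + 2\<close> is 6b^3 - 29b^2 + 46b - 22; borrowing gives the digits b - 22, 45, b -
      29, 5.\<close>
    have "digit_sum (p + 2) (?n + 2) = (6 * k + 51) + 45 + (6 * k + 44) + 5"
      by (rule digit_sum_4_digits) (simp_all add: p_def q_def r_def algebra_simps)
    also have "\<dots> = 2 * (p + 1) + 1"
      by (simp add: p_def)
    finally show ?thesis .
  qed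
  have digit_sum_q: "digit_sum (q + 2) (?n + 2) = 2 * (q + 1) + 1"
  proof -
    \<comment> \<open>The number is about 3/4 of the cube of the base, hence the top digit 0; for
      \<open>r\<close> below the ratio is about 2/9.\<close>
    have "digit_sum (q + 2) (?n + 2) = (6 * k + 67) + (9 * k + 119) + (9 * k + 103) + 0"
      by (rule digit_sum_4_digits) (simp_all add: p_def q_def r_def algebra_simps)
    also have "\<dots> = 2 * (q + 1) + 1"
      by (simp add: q_def)
    finally show ?thesis .
  qed
  have digit_sum_r: "digit_sum (r + 2) (?n + 2) = 1 * (r + 1) + 1"
  proof -
    have "digit_sum (r + 2) (?n + 2) = (8 * k + 94) + (6 * k + 77) + (4 * k + 46) + 0"
      by (rule digit_sum_4_digits) (simp_all add: p_def q_def r_def algebra_simps)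
    also have "\<dots> = 1 * (r + 1) + 1"
      by (simp add: r_def)
    finally show ?thesis .
  qed
  \<comment> \<open>The digit sums are kept in the shape \<open>c * (s + 1) + 1\<close>, including
    \<open>1 *\<close> for \<open>r\<close>, so that this single rule rewrites all three.\<close>
  have quotient: "(rat_of_nat (c * (s + 1) + 1) - 1) / rat_of_nat (s + 1) = rat_of_nat c" for c s
  proof -
    have "rat_of_nat (c * (s + 1) + 1) - 1 = rat_of_nat c * rat_of_nat (s + 1)"
      by (simp only: of_nat_add of_nat_mult of_nat_1 add_diff_cancel_right')
    moreover have "rat_of_nat (s + 1) \<noteq> 0"
      by (simp only: of_nat_eq_0_iff)
    ultimately show ?thesis by (metis nonzero_mult_div_cancel_right)
  qed
  show "lc_degree ?n = 2"
    unfolding lc_degree_def primes image_insert image_empty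
      digit_sum_p digit_sum_q digit_sum_r quotient by simp
qed

text \<open>The predicted count is unbounded, since powers of the logarithm grow more slowly than
  \<open>x\<close>, whereas a finite set would bound it.\<close>

lemma prime_k_tuples_conjecture_infinite:
  fixes k :: nat and a :: "nat \<Rightarrow> nat" and b :: "nat \<Rightarrow> int"
  assumes "prime_k_tuples_conjecture" "k \<ge> 1"
    and "\<And>i. i \<in> {1..k} \<Longrightarrow> a i > 0" "\<And>i. i \<in> {1..k} \<Longrightarrow> b i \<noteq> 0"
    and "inj_on (\<lambda>i. (a i, b i)) {1..k}"
    and "\<And>p::int. prime p \<Longrightarrow> \<exists>m\<ge>1. \<not> p dvd (\<Prod>i=1..k. int (a i) * int m + b i)"
  shows "infinite {m::nat. \<forall>i\<in>{1..k}. prime (int (a i) * int m + b i)}" (is "infinite ?M")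
proof
  assume fin: "finite ?M"
  obtain c where c: "c > 0"
    "(\<lambda>x. real (tuple_count k a b x)) \<sim>[at_top] (\<lambda>x. c * x / ln x ^ k)"
    using assms(1) [unfolded prime_k_tuples_conjecture_def, rule_format, OF assms(2-5)] assms(6)
    by blast
  \<comment> \<open>Substitute y = \<open>ln x\<close> in the limit of y^k / exp y.\<close>
  have "((\<lambda>x. ln x ^ k / exp (ln x)) \<longlongrightarrow> (0::real)) at_top"
    by (rule filterlim_compose [OF tendsto_power_div_exp_0 ln_at_top])
  moreover have pos: "eventually (\<lambda>x::real. x > 0 \<and> ln x > 0) at_top"
    using eventually_gt_at_top [of 1] by eventually_elim simp
  ultimately have "((\<lambda>x. ln x ^ k / x) \<longlongrightarrow> (0::real)) at_top"
    by (elim Lim_transform_eventually) (auto elim: eventually_mono)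
  then have "filterlim (\<lambda>x::real. inverse (ln x ^ k / x)) at_top at_top"
    by (rule filterlim_inverse_at_top) (use pos in \<open>auto elim: eventually_mono\<close>)
  then have "filterlim (\<lambda>x::real. x / ln x ^ k) at_top at_top"
    by simp
  then have "filterlim (\<lambda>x. c * (x / ln x ^ k)) at_top at_top"
    using c(1) by (intro filterlim_tendsto_pos_mult_at_top [OF tendsto_const])
  then have "filterlim (\<lambda>x. real (tuple_count k a b x)) at_top at_top"
    using asymp_equiv_at_top_transfer [OF asymp_equiv_symI [OF c(2)]] by simp
  then have "eventually (\<lambda>x. real (tuple_count k a b x) > real (card ?M)) at_top"
    unfolding filterlim_at_top_dense by blast
  moreover have "tuple_count k a b x \<le> card ?M" for x
    unfolding tuple_count_def by (rule card_mono [OF fin]) auto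
  ultimately show False
    by (simp add: not_less [symmetric])
qed

theorem theorem4p1:
  shows "prime_k_tuples_conjecture \<longrightarrow>
    infinite {n :: nat. lucas_carmichael n \<and> lc_degree n = 2 \<and> card {p. prime p \<and> p dvd n} = 3}"
proof
  assume conj: "prime_k_tuples_conjecture"
  define M where "M = {m::nat. \<forall>i\<in>{1..3::nat}. prime (int (6 * i) * int m + (- 1))}"
  have interval: "{1..3::nat} = {1, 2, 3}" by auto
  have "infinite M"
    unfolding M_def
  proof (rule prime_k_tuples_conjecture_infinite [OF conj])
    fix p :: int
    assume p: "prime p"
    \<comment> \<open>The witness \<open>m = nat p\<close> makes every factor congruent to -1 modulo
      \<open>p\<close>.\<close>
    have "\<not> p dvd (\<Prod>i=1..3. int (6 * i) * int (nat p) + - 1)"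
    proof
      assume "p dvd (\<Prod>i=1..3. int (6 * i) * int (nat p) + - 1)"
      then obtain i where "p dvd int (6 * i) * int (nat p) + - 1"
        using p by (auto simp: prime_dvd_prod_iff)
      moreover have "p dvd int (6 * i) * int (nat p)"
        using prime_gt_0_int [OF p] by simp
      ultimately have "p dvd - 1" by (metis dvd_add_right_iff)
      then show False using p by (simp add: not_prime_unit)
    qed
    moreover have "nat p \<ge> 1"
      using prime_gt_0_int [OF p] by simp
    ultimately show "\<exists>m\<ge>1. \<not> p dvd (\<Prod>i=1..3. int (6 * i) * int m + - 1)"
      by blast
  qed (auto simp: inj_on_def)
  \<comment> \<open>Beyond this cut \<open>m - 12\<close> is exact, hence injective, and distinct
    \<open>m\<close> give distinct products by monotonicity of \<open>f\<close>.\<close>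
  then have inf: "infinite (M - {..<12})"
    by simp
  define f :: "nat \<Rightarrow> nat" where "f k = (6 * k + 71) * (12 * k + 143) * (18 * k + 215)" for k
  have "strict_mono f"
    unfolding f_def strict_mono_def by (intro allI impI mult_strict_mono) auto
  then have "inj_on (\<lambda>m. f (m - 12)) (M - {..<12})"
    by (auto simp: inj_on_def strict_mono_eq)
  then have "infinite ((\<lambda>m. f (m - 12)) ` (M - {..<12}))"
    using inf by (simp add: finite_image_iff)
  moreover have "(\<lambda>m. f (m - 12)) ` (M - {..<12}) \<subseteq>
    {n. lucas_carmichael n \<and> lc_degree n = 2 \<and> card {p. prime p \<and> p dvd n} = 3}"
  proof (rule image_subsetI)
    fix m
    assume m: "m \<in> M - {..<12}"
    define k where "k = m - 12"
    have k: "m = k + 12" using m by (simp add: k_def)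
    have "prime (int (6 * i) * int m + - 1)" if "i \<in> {1, 2, 3}" for i
      using m that unfolding M_def interval by blast
    from this [of 1] this [of 2] this [of 3]
    have "prime (int (6 * k + 71))" "prime (int (12 * k + 143))" "prime (int (18 * k + 215))"
      by (simp_all add: k algebra_simps)
    then have "prime (6 * k + 71)" "prime (12 * k + 143)" "prime (18 * k + 215)"
      unfolding prime_nat_int_transfer .
    from chernick_lucas_carmichael [OF this]
    show "f (m - 12) \<in> {n. lucas_carmichael n \<and> lc_degree n = 2 \<and> card {p. prime p \<and> p dvd n} = 3}"
      by (simp add: f_def k)
  qed
  ultimately show "infinite {n. lucas_carmichael n \<and> lc_degree n = 2 \<and> card {p. prime p \<and> p dvd n} = 3}"
    using finite_subset by blast
qed

end
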